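(* Let $(X,\mu)$ be a $\sigma$-finite measure space, let $\mathcal{D}$ be a finite collection of dyadic cubes on $(X,\mu)$, let $1/\alpha(\cdot)\in\mathcal{P}(X,\mu)$ and let $\eta\in (0,1)$. Let $f\in L^1_{\mathrm{loc}}$ and let $Q_0\in\mathcal{D}$ be a fixed cube. Then there exists a family $\mathcal{S}_f(Q_0) \subset\mathcal{D}(Q_0)$ that is $(\eta,\psi_\alpha)$-sparse, for $\psi_\alpha(Q):=\mu(Q)^{1-\langle\alpha\rangle_Q}$, with associated pairwise disjoint major subsets $E(S)\subset S$, $S\in\mathcal S_f(Q_0)$, so that $$M^{\alpha(\cdot)}_{\mu,\mathcal{D}(Q_0)}f\leq \frac{1}{1-\eta}\sum_{S\in\mathcal{S}_f(Q_0)}\frac{1_{E(S)}}{\mu(S)^{1-\langle\alpha\rangle_S}} \int_S|f|\,d\mu \leq \frac{1}{1-\eta}\mathcal{A}^{\alpha(\cdot)}_{\mu,\mathcal{S}_f(Q_0)}|f|$$ holds $\mu$-almost everywhere.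
   Context: $\mathcal{P}(X,\mu)$ is the set of measurable functions $p(\cdot):X\to[1,\infty]$; with $1/0=\infty$, the condition $1/\alpha(\cdot)\in\mathcal P(X,\mu)$ means that $\alpha:X\to[0,1]$ is measurable. A collection $\mathcal D$ of dyadic cubes is a countable (here finite) collection of measurable sets with $0<\mu(Q)<\infty$ for each $Q\in\mathcal D$ and $Q\cap Q'\in\{Q,Q',\emptyset\}$ for all $Q,Q'\in\mathcal D$. Write $\mathcal D(Q_0)=\{Q\in\mathcal D:Q\subset Q_0\}$ and $\langle\alpha\rangle_A=\frac1{\mu(A)}\int_A\alpha\,d\mu$. Here $f\in L^1_{\mathrm{loc}}$ means $f$ is measurable and $\int_Q|f|\,d\mu<\infty$ for all $Q\in\mathcal D$. For a collection $\mathcal B$ of such sets, $$M^{\alpha(\cdot)}_{\mu,\mathcal B}f=\sup_{Q\in\mathcal B}\frac{1_Q}{\mu(Q)^{1-\langle\alpha\rangle_Q}}\int_Q|f|\,d\mu,\qquad \mathcal A^{\alpha(\cdot)}_{\mu,\mathcal B}f=\sum_{B\in\mathcal B}\frac{1_B}{\mu(B)^{1-\langle\alpha\rangle_B}}\int_Bf\,d\mu.$$ Sparsity: for a non-negative set function $\psi$ and $\eta\in(0,1]$, a measurable set $E(B)\subset B$ is an $(\eta,\psi)$-major subset of $B$ if $\psi(B\setminus E(B))\le(1-\eta)\psi(B)$. A collection $\mathcal B$ is $(\eta,\psi)$-sparse if for each $B\in\mathcal B$ there is an $(\eta,\psi)$-major subset $E(B)\subset B$ and these sets are pairwise disjoint.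 Convention: $\psi_\alpha(A)=\mu(A)^{1-\langle\alpha\rangle_A}$ for $0<\mu(A)<\infty$, and $\psi_\alpha(A)=0$ if $\mu(A)=0$. *)

theory Defs
  imports "HOL-Analysis.Analysis"
begin

definition dyadic_cubes :: "'a measure \<Rightarrow> 'a set set \<Rightarrow> bool" where
  "dyadic_cubes M D \<longleftrightarrow> countable D \<and>
     (\<forall>Q\<in>D. Q \<in> sets M \<and> 0 < emeasure M Q \<and> emeasure M Q < \<infinity>) \<and>
     (\<forall>Q\<in>D. \<forall>Q'\<in>D. Q \<inter> Q' \<in> {Q, Q', {}})"

definition subcubes :: "'a set set \<Rightarrow> 'a set \<Rightarrow> 'a set set" where
  "subcubes D Q\<^sub>0 = {Q \<in> D. Q \<subseteq> Q\<^sub>0}"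

definition average :: "'a measure \<Rightarrow> ('a \<Rightarrow> real) \<Rightarrow> 'a set \<Rightarrow> real" where
  "average M \<alpha> A = (LINT x:A|M. \<alpha> x) / measure M A"

(* Only meant for sets of finite measure. Since 0 powr a = 0, the value on
   null sets is 0, as required by the convention for psi_alpha. *)
definition frac_content :: "'a measure \<Rightarrow> ('a \<Rightarrow> real) \<Rightarrow> 'a set \<Rightarrow> real" where
  "frac_content M \<alpha> A = measure M A powr (1 - average M \<alpha> A)"

definition loc_integrable :: "'a measure \<Rightarrow> 'a set set \<Rightarrow> ('a \<Rightarrow> 'b::real_normed_vector) \<Rightarrow> bool" where
  "loc_integrable M D f \<longleftrightarrow> f \<in> borel_measurable M \<and>
     (\<forall>Q\<in>D. (\<integral>\<^sup>+x\<in>Q. ennreal (norm (f x)) \<partial>M) < \<infinity>)"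

(* Valued in ennreal, so that the supremum exists for every collection
   (and is 0 at points covered by no member). *)
definition frac_maximal ::
  "'a measure \<Rightarrow> ('a \<Rightarrow> real) \<Rightarrow> 'a set set \<Rightarrow> ('a \<Rightarrow> 'b::real_normed_vector) \<Rightarrow> 'a \<Rightarrow> ennreal" where
  "frac_maximal M \<alpha> \<B> f x =
     (SUP Q\<in>\<B>. indicator Q x / ennreal (frac_content M \<alpha> Q) * (\<integral>\<^sup>+y\<in>Q. ennreal (norm (f y)) \<partial>M))"

(* Meant for finite collections: the sum over an infinite set is 0 by convention. *)
definition sparse_operator ::
  "'a measure \<Rightarrow> ('a \<Rightarrow> real) \<Rightarrow> 'a set set \<Rightarrow>
     ('a \<Rightarrow> 'b::{banach, second_countable_topology}) \<Rightarrow> 'a \<Rightarrow> 'b" where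
  "sparse_operator M \<alpha> \<B> f x =
     (\<Sum>B\<in>\<B>. (indicator B x / frac_content M \<alpha> B) *\<^sub>R (LINT y:B|M. f y))"

definition major_subset :: "'a measure \<Rightarrow> real \<Rightarrow> ('a set \<Rightarrow> real) \<Rightarrow> 'a set \<Rightarrow> 'a set \<Rightarrow> bool" where
  "major_subset M \<eta> \<psi> B E \<longleftrightarrow> E \<in> sets M \<and> E \<subseteq> B \<and> \<psi> (B - E) \<le> (1 - \<eta>) * \<psi> B"

definition sparse_with ::
  "'a measure \<Rightarrow> real \<Rightarrow> ('a set \<Rightarrow> real) \<Rightarrow> 'a set set \<Rightarrow> ('a set \<Rightarrow> 'a set) \<Rightarrow> bool" where
  "sparse_with M \<eta> \<psi> \<B> E \<longleftrightarrow>
     (\<forall>B\<in>\<B>. major_subset M \<eta> \<psi> B (E B)) \<and> disjoint_family_on E \<B>"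

end

theory Submission
  imports Defs
begin

text \<open>The proof is a stopping time argument. Write \<open>\<psi>\<close> for the fractional content,
  \<open>a Q = (\<integral>\<^sub>Q |f|) / \<psi> Q\<close> and \<open>\<Lambda> = 1 / (1 - \<eta>)\<close>. The family \<open>\<S>\<close> consists of the cubes \<open>Q\<close>
  whose value \<open>a Q\<close> exceeds \<open>\<Lambda> a S\<close> for every selected \<open>S\<close> properly containing \<open>Q\<close>. This rule
  decides about \<open>Q\<close> once the larger cubes have been decided, so that it does define a family, and a
  cube that is rejected satisfies \<open>a Q \<le> \<Lambda> a S\<close> for some selected \<open>S\<close> containing it. Hence
  selected cubes alone control the maximal function, up to the factor \<open>\<Lambda>\<close>.

  For \<open>E S\<close> take the points of \<open>S\<close> that lie in no smaller selected cube. By nestedness these sets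
  are disjoint. Since \<open>a\<close> increases along a chain of shrinking selected cubes, at each point
  the largest value of \<open>a\<close> is attained by the smallest selected cube, which is the one with
  \<open>x \<in> E S\<close>; so the supremum over all cubes is bounded by a single term of the sum.

  It remains to see that \<open>E S\<close> is a major subset. The set \<open>S - E S\<close> is a disjoint union of cubes \<open>T\<close>
  with \<open>a T > \<Lambda> a S\<close>, that is, \<open>\<psi> T \<cdot> \<Lambda> \<cdot> \<integral>\<^sub>S |f| < \<psi> S \<cdot> \<integral>\<^sub>T |f|\<close>. Summing over \<open>T\<close> bounds
  \<open>\<Sum> \<psi> T\<close> by \<open>(1 - \<eta>) \<psi> S\<close>, and one needs that \<open>\<psi>\<close> is subadditive over disjoint unions.
  Since the exponent varies with the set, this is not immediate; it follows from the
  convexity of \<open>t \<mapsto> m powr t\<close>, because the average over a union is the convex combination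
  of the averages over the parts (\<open>powr_weighted_mean_le_sum\<close>, \<open>frac_content_Union_le\<close>).\<close>

section \<open>Subadditivity of the fractional content\<close>

text \<open>With weights \<open>w i = m i / (\<Sum> m)\<close>, Jensen's inequality bounds the left side by
  \<open>\<Sum> w i * (\<Sum> m) powr b i\<close>. As \<open>w i \<le> 1\<close> and \<open>b i \<le> 1\<close>, each factor \<open>w i\<close> is at most
  \<open>w i powr b i\<close>, which can be absorbed into the power.\<close>

lemma powr_weighted_mean_le_sum:
  fixes m b :: "'i \<Rightarrow> real"
  assumes fin: "finite I" and m: "\<And>i. i \<in> I \<Longrightarrow> 0 \<le> m i" and b: "\<And>i. i \<in> I \<Longrightarrow> b i \<le> 1"
    and pos: "0 < sum m I"
  shows "sum m I powr ((\<Sum>i\<in>I. m i * b i) / sum m I) \<le> (\<Sum>i\<in>I. m i powr b i)"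
proof -
  define t where "t = sum m I"
  define w where "w i = m i / t" for i
  have t: "0 < t" using pos by (simp add: t_def)
  have w0: "0 \<le> w i" if "i \<in> I" for i using m[OF that] t by (simp add: w_def)
  have w1: "w i \<le> 1" if "i \<in> I" for i
    using member_le_sum[of i I m] that m fin t by (simp add: w_def t_def)
  have sw: "sum w I = 1"
    using t by (simp add: w_def t_def flip: sum_divide_distrib)
  have "I \<noteq> {}" using pos by auto
  have "t powr ((\<Sum>i\<in>I. m i * b i) / t) = exp (\<Sum>i\<in>I. w i *\<^sub>R (b i * ln t))"
    using t by (simp add: powr_def w_def sum_divide_distrib sum_distrib_right mult.assoc)
  also have "\<dots> \<le> (\<Sum>i\<in>I. w i * exp (b i * ln t))"
    by (rule convex_on_sum[OF fin \<open>I \<noteq> {}\<close> exp_convex sw w0]) auto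
  also have "\<dots> = (\<Sum>i\<in>I. w i * t powr b i)"
    using t by (simp add: powr_def)
  also have "\<dots> \<le> (\<Sum>i\<in>I. m i powr b i)"
  proof (rule sum_mono)
    fix i assume i: "i \<in> I"
    have "w i = w i powr 1" using w0[OF i] by simp
    also have "\<dots> \<le> w i powr b i" by (rule powr_mono'[OF b[OF i] w0[OF i] w1[OF i]])
    finally have "w i * t powr b i \<le> w i powr b i * t powr b i"
      by (rule mult_right_mono) simp
    also have "\<dots> = m i powr b i"
      using t w0[OF i] by (simp add: w_def flip: powr_mult)
    finally show "w i * t powr b i \<le> m i powr b i" .
  qed
  finally show ?thesis by (simp add: t_def)
qed

lemma measure_times_average:
  assumes "A \<in> fmeasurable M"
  shows "measure M A * average M \<alpha> A = (LINT x:A|M. \<alpha> x)"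
proof (cases "measure M A = 0")
  case True
  then have "A \<in> null_sets M"
    using assms by (simp add: fmeasurableD null_sets_def emeasure_eq_measure2)
  then have "AE x in M. indicator A x *\<^sub>R \<alpha> x = 0"
    using AE_not_in[of A M] by (auto elim: eventually_mono)
  then have "(LINT x:A|M. \<alpha> x) = 0"
    unfolding set_lebesgue_integral_def by (rule integral_eq_zero_AE)
  then show ?thesis using True by simp
qed (simp add: average_def)

lemma frac_content_nonneg: "0 \<le> frac_content M \<alpha> A"
  by (simp add: frac_content_def)

lemma frac_content_Union_le:
  assumes fin: "finite \<C>" and disj: "disjoint \<C>"
    and fm: "\<And>Q. Q \<in> \<C> \<Longrightarrow> Q \<in> fmeasurable M"
    and int: "\<And>Q. Q \<in> \<C> \<Longrightarrow> set_integrable M Q \<alpha>"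
    and nonneg: "\<And>x. x \<in> space M \<Longrightarrow> 0 \<le> \<alpha> x"
  shows "frac_content M \<alpha> (\<Union>\<C>) \<le> (\<Sum>Q\<in>\<C>. frac_content M \<alpha> Q)"
proof (cases "measure M (\<Union>\<C>) = 0")
  case True
  then show ?thesis
    by (simp add: frac_content_def[of _ _ "\<Union>\<C>"] sum_nonneg frac_content_nonneg)
next
  case False
  have fmU: "\<Union>\<C> \<in> fmeasurable M"
    using fmeasurable.finite_Union[of \<C> M] fin fm by blast
  have dj: "disjoint_family_on (\<lambda>Q. Q) \<C>"
    using disj by (auto simp: disjoint_family_on_def disjoint_def)
  have mU: "measure M (\<Union>\<C>) = (\<Sum>Q\<in>\<C>. measure M Q)"
    using measure_finite_Union[of \<C> "\<lambda>Q. Q" M] fin dj fm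
    by (auto simp: fmeasurable_def less_top)
  have "measure M (\<Union>\<C>) * average M \<alpha> (\<Union>\<C>) = (\<Sum>Q\<in>\<C>. LINT x:Q|M. \<alpha> x)"
    using set_integral_finite_Union[of \<C> "\<lambda>Q. Q" M \<alpha>] fin dj int fm
    by (simp add: measure_times_average[OF fmU] fmeasurableD)
  also have "\<dots> = (\<Sum>Q\<in>\<C>. measure M Q * average M \<alpha> Q)"
    by (simp add: measure_times_average fm)
  finally have "1 - average M \<alpha> (\<Union>\<C>)
      = (\<Sum>Q\<in>\<C>. measure M Q * (1 - average M \<alpha> Q)) / (\<Sum>Q\<in>\<C>. measure M Q)"
    using False by (simp add: mU field_simps sum_subtractf)
  moreover have "0 \<le> average M \<alpha> Q" for Q
    unfolding average_def set_lebesgue_integral_def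
    by (intro divide_nonneg_nonneg Bochner_Integration.integral_nonneg)
       (auto simp: nonneg indicator_def)
  moreover have "0 < (\<Sum>Q\<in>\<C>. measure M Q)"
    using False by (simp add: zero_less_measure_iff flip: mU)
  ultimately show ?thesis
    using powr_weighted_mean_le_sum[OF fin, of "measure M" "\<lambda>Q. 1 - average M \<alpha> Q"]
    by (simp add: frac_content_def mU)
qed

section \<open>The stopping family and its minimal parts\<close>

text \<open>The kernel of a well-founded digraph: membership of \<open>q\<close> is decided by the members below \<open>q\<close>.\<close>

lemma wf_kernel_exists:
  assumes "wf R"
  shows "\<exists>K. \<forall>q. q \<in> K \<longleftrightarrow> (\<forall>s\<in>K. (s, q) \<notin> R)"
proof -
  define k where "k = wfrec R (\<lambda>k q. \<forall>s. (s, q) \<in> R \<longrightarrow> \<not> k s)"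
  have "k q \<longleftrightarrow> (\<forall>s. (s, q) \<in> R \<longrightarrow> \<not> k s)" for q
    unfolding k_def by (subst wfrec[OF assms]) (simp add: cut_apply)
  then show ?thesis by (intro exI[of _ "Collect k"]) blast
qed

text \<open>The kernel of the relation that links \<open>Q\<close> to each larger \<open>S\<close> with \<open>a Q \<le> c * a S\<close>.
  Being independent it has the growth property, and being dominating the covering property.\<close>

lemma stopping_family_exists:
  fixes a :: "'a set \<Rightarrow> real"
  assumes fin: "finite F" and c: "1 \<le> c" and a: "\<And>Q. Q \<in> F \<Longrightarrow> 0 \<le> a Q"
  obtains K where "K \<subseteq> F"
    and "\<And>S T. S \<in> K \<Longrightarrow> T \<in> K \<Longrightarrow> T \<subset> S \<Longrightarrow> c * a S < a T"
    and "\<And>Q. Q \<in> F \<Longrightarrow> \<exists>S\<in>K. Q \<subseteq> S \<and> a Q \<le> c * a S"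
proof -
  define R where "R = {(S, Q). S \<in> F \<and> Q \<in> F \<and> Q \<subset> S \<and> a Q \<le> c * a S}"
  have "wf {(S, Q). S \<in> F \<and> Q \<in> F \<and> Q \<subset> S}"
  proof (rule finite_acyclic_wf)
    show "finite {(S, Q). S \<in> F \<and> Q \<in> F \<and> Q \<subset> S}"
      by (rule finite_subset[of _ "F \<times> F"]) (auto simp: fin)
    show "acyclic {(S, Q). S \<in> F \<and> Q \<in> F \<and> Q \<subset> S}"
      by (rule acyclicI_order[of _ "\<lambda>Q. Q"]) auto
  qed
  then have "wf R" by (rule wf_subset) (auto simp: R_def)
  then obtain K where K: "\<And>q. q \<in> K \<longleftrightarrow> (\<forall>s\<in>K. (s, q) \<notin> R)"
    using wf_kernel_exists by blast
  show thesis
  proof (rule that[of "K \<inter> F"])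
    show "c * a S < a T" if "S \<in> K \<inter> F" "T \<in> K \<inter> F" "T \<subset> S" for S T
      using that K[of T] by (force simp: R_def)
    show "\<exists>S\<in>K \<inter> F. Q \<subseteq> S \<and> a Q \<le> c * a S" if "Q \<in> F" for Q
    proof (cases "Q \<in> K")
      case True
      moreover have "1 * a Q \<le> c * a Q" using c a[OF that] by (rule mult_right_mono)
      ultimately show ?thesis using that by auto
    next
      case False
      then show ?thesis using K[of Q] by (auto simp: R_def)
    qed
  qed simp
qed

definition minimal_part :: "'a set set \<Rightarrow> 'a set \<Rightarrow> 'a set" where
  "minimal_part K S = S - \<Union>{T \<in> K. T \<subset> S}"

lemma disjoint_family_on_minimal_part:
  assumes nested: "\<And>S T. S \<in> K \<Longrightarrow> T \<in> K \<Longrightarrow> S \<inter> T \<in> {S, T, {}}"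
  shows "disjoint_family_on (minimal_part K) K"
  unfolding disjoint_family_on_def
proof (intro ballI impI)
  fix S T assume ST: "S \<in> K" "T \<in> K" "S \<noteq> T"
  have "S \<subset> T \<or> T \<subset> S \<or> S \<inter> T = {}"
    using nested[OF ST(1,2)] ST(3) by auto
  then show "minimal_part K S \<inter> minimal_part K T = {}"
    using ST by (auto simp: minimal_part_def)
qed

lemma minimal_part_below:
  assumes "finite K" "S \<in> K" "x \<in> S"
  obtains T where "T \<in> K" "T \<subseteq> S" "x \<in> minimal_part K T"
proof -
  obtain T where T: "T \<in> {T \<in> K. x \<in> T}" "T \<subseteq> S"
      "\<forall>U\<in>{T \<in> K. x \<in> T}. U \<subseteq> T \<longrightarrow> T = U"
    using finite_has_minimal2[of "{T \<in> K. x \<in> T}" S] assms by auto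
  then have "x \<in> minimal_part K T" by (auto simp: minimal_part_def)
  with T that show thesis by blast
qed

text \<open>The maximal members of a finite nested family are disjoint and have the same union.\<close>

lemma nested_Union_eq_disjoint_Union:
  assumes fin: "finite K" and nested: "\<And>S T. S \<in> K \<Longrightarrow> T \<in> K \<Longrightarrow> S \<inter> T \<in> {S, T, {}}"
  obtains C where "C \<subseteq> K" "disjoint C" "\<Union>C = \<Union>K"
proof (rule that[of "{T \<in> K. \<forall>U\<in>K. T \<subseteq> U \<longrightarrow> T = U}"])
  show "disjoint {T \<in> K. \<forall>U\<in>K. T \<subseteq> U \<longrightarrow> T = U}"
  proof (rule disjointI)
    fix S T
    assume S: "S \<in> {T \<in> K. \<forall>U\<in>K. T \<subseteq> U \<longrightarrow> T = U}"
      and T: "T \<in> {T \<in> K. \<forall>U\<in>K. T \<subseteq> U \<longrightarrow> T = U}" and "S \<noteq> T"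
    then have "\<not> S \<subseteq> T" "\<not> T \<subseteq> S" by auto
    then show "S \<inter> T = {}" using nested[of S T] S T by auto
  qed
  show "\<Union>{T \<in> K. \<forall>U\<in>K. T \<subseteq> U \<longrightarrow> T = U} = \<Union>K"
  proof
    show "\<Union>K \<subseteq> \<Union>{T \<in> K. \<forall>U\<in>K. T \<subseteq> U \<longrightarrow> T = U}"
    proof
      fix x assume "x \<in> \<Union>K"
      then obtain S where "S \<in> K" "x \<in> S" by blast
      then obtain T where "T \<in> K" "S \<subseteq> T" "\<forall>U\<in>K. T \<subseteq> U \<longrightarrow> T = U"
        using finite_has_maximal2[OF fin, of S] by auto
      with \<open>x \<in> S\<close> show "x \<in> \<Union>{T \<in> K. \<forall>U\<in>K. T \<subseteq> U \<longrightarrow> T = U}" by blast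
    qed
  qed auto
qed auto

section \<open>The removed part of a stopping cube is small\<close>

lemma sum_set_integral_le_superset:
  fixes g :: "'a \<Rightarrow> real"
  assumes fin: "finite \<C>" and disj: "disjoint \<C>" and meas: "\<C> \<subseteq> sets M"
    and sub: "\<Union>\<C> \<subseteq> S" and int: "set_integrable M S g" and nonneg: "\<And>x. 0 \<le> g x"
  shows "(\<Sum>T\<in>\<C>. LINT x:T|M. g x) \<le> (LINT x:S|M. g x)"
proof -
  have T: "set_integrable M T g" if "T \<in> \<C>" for T
    by (rule set_integrable_subset[OF int]) (use that meas sub in auto)
  have U: "set_integrable M (\<Union>\<C>) g"
    by (rule set_integrable_subset[OF int]) (use fin meas sub in auto)
  have "disjoint_family_on (\<lambda>T. T) \<C>"
    using disj by (auto simp: disjoint_family_on_def disjoint_def)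
  then have "(\<Sum>T\<in>\<C>. LINT x:T|M. g x) = (LINT x:\<Union>\<C>|M. g x)"
    using set_integral_finite_Union[of \<C> "\<lambda>T. T" M g] fin T meas by (auto simp: subset_iff)
  also have "\<dots> \<le> (LINT x:S|M. g x)"
    unfolding set_lebesgue_integral_def
    by (rule integral_mono[OF U[unfolded set_integrable_def] int[unfolded set_integrable_def]])
       (use sub nonneg in \<open>auto simp: indicator_def\<close>)
  finally show ?thesis .
qed

text \<open>The weak type estimate behind sparsity: where the ratio of \<open>\<integral> g\<close> to the fractional content
  has grown by the factor \<open>c\<close>, at most the fraction \<open>1 / c\<close> of the content is left, since the
  integrals over disjoint subsets add up to at most \<open>\<integral>\<^sub>S g\<close>.\<close>

lemma frac_content_growth_le:
  fixes g :: "'a \<Rightarrow> real"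
  assumes fin: "finite \<C>" and disj: "disjoint \<C>"
    and fm: "\<And>Q. Q \<in> \<C> \<Longrightarrow> Q \<in> fmeasurable M"
    and int\<alpha>: "\<And>Q. Q \<in> \<C> \<Longrightarrow> set_integrable M Q \<alpha>"
    and nonneg: "\<And>x. x \<in> space M \<Longrightarrow> 0 \<le> \<alpha> x"
    and sub: "\<Union>\<C> \<subseteq> S" and int: "set_integrable M S g" and g: "\<And>x. 0 \<le> g x"
    and pos: "0 < frac_content M \<alpha> S" "\<And>T. T \<in> \<C> \<Longrightarrow> 0 < frac_content M \<alpha> T"
    and c: "0 < c"
    and grow: "\<And>T. T \<in> \<C> \<Longrightarrow>
      c * ((LINT x:S|M. g x) / frac_content M \<alpha> S) < (LINT x:T|M. g x) / frac_content M \<alpha> T"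
  shows "frac_content M \<alpha> (\<Union>\<C>) \<le> frac_content M \<alpha> S / c"
proof (cases "\<C> = {}")
  case True
  then show ?thesis using pos(1) c by (simp add: frac_content_def)
next
  case False
  define I where "I A = (LINT x:A|M. g x)" for A
  define \<psi> where "\<psi> = frac_content M \<alpha>"
  have sum_I: "sum I \<C> \<le> I S"
    unfolding I_def
    by (rule sum_set_integral_le_superset[OF fin disj _ sub int g]) (use fm in auto)
  have I_nonneg: "0 \<le> I A" for A
    unfolding I_def set_lebesgue_integral_def
    by (rule Bochner_Integration.integral_nonneg) (simp add: g)
  have step: "\<psi> T * (c * I S) < \<psi> S * I T" if "T \<in> \<C>" for T
    using grow[OF that] pos(1) pos(2)[OF that]
    by (simp add: I_def \<psi>_def field_simps)
  \<comment> \<open>If the integral over \<open>S\<close> vanished, a member of the family would have positive integral.\<close>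
  have "I S \<noteq> 0"
  proof
    assume 0: "I S = 0"
    obtain T where "T \<in> \<C>" using False by blast
    moreover have "I T \<le> 0"
      using sum_I 0 member_le_sum[of T \<C> I] I_nonneg fin \<open>T \<in> \<C>\<close> by auto
    ultimately show False
      using step[of T] 0 I_nonneg[of T] by simp
  qed
  then have "0 < I S" using I_nonneg[of S] by simp
  have "(\<Sum>T\<in>\<C>. \<psi> T) * (c * I S) \<le> \<psi> S * sum I \<C>"
    unfolding sum_distrib_right sum_distrib_left
    by (rule sum_mono) (use step in force)
  also have "\<dots> \<le> \<psi> S * I S"
    using sum_I pos(1) by (simp add: \<psi>_def)
  finally have "(\<Sum>T\<in>\<C>. \<psi> T) \<le> \<psi> S / c"
    using \<open>0 < I S\<close> c by (simp add: field_simps)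
  moreover have "\<psi> (\<Union>\<C>) \<le> (\<Sum>T\<in>\<C>. \<psi> T)"
    unfolding \<psi>_def by (rule frac_content_Union_le[OF fin disj fm int\<alpha> nonneg])
  ultimately show ?thesis by (simp add: \<psi>_def)
qed

section \<open>Pointwise sparse domination\<close>

theorem proposition3p4:
  fixes M :: "'a measure"
    and D :: "'a set set"
    and \<alpha> :: "'a \<Rightarrow> real"
    and \<eta> :: real
    and f :: "'a \<Rightarrow> 'k::{real_normed_field, banach, second_countable_topology}"
    and Q\<^sub>0 :: "'a set"
  assumes "sigma_finite_measure M"
    and "dyadic_cubes M D" and "finite D"
    and "\<alpha> \<in> borel_measurable M" and "\<And>x. x \<in> space M \<Longrightarrow> \<alpha> x \<in> {0..1}"
    and "\<eta> \<in> {0<..<1}"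
    and "loc_integrable M D f"
    and "Q\<^sub>0 \<in> D"
  shows "\<exists>\<S> E. \<S> \<subseteq> subcubes D Q\<^sub>0 \<and> sparse_with M \<eta> (frac_content M \<alpha>) \<S> E \<and>
    (AE x in M.
       frac_maximal M \<alpha> (subcubes D Q\<^sub>0) f x
         \<le> ennreal (1 / (1 - \<eta>) * (\<Sum>S\<in>\<S>. indicator (E S) x / frac_content M \<alpha> S *
                                             (LINT y:S|M. norm (f y)))) \<and>
       1 / (1 - \<eta>) * (\<Sum>S\<in>\<S>. indicator (E S) x / frac_content M \<alpha> S *
                                             (LINT y:S|M. norm (f y)))
         \<le> 1 / (1 - \<eta>) * sparse_operator M \<alpha> \<S> (\<lambda>y. norm (f y)) x)"
proof -
  define \<psi> where "\<psi> = frac_content M \<alpha>"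
  define I where "I Q = (LINT y:Q|M. norm (f y))" for Q
  define a where "a Q = I Q / \<psi> Q" for Q
  define \<Lambda> where "\<Lambda> = 1 / (1 - \<eta>)"
  have \<Lambda>: "1 \<le> \<Lambda>" "0 < \<Lambda>" using assms(6) by (auto simp: \<Lambda>_def field_simps)

  have meas: "Q \<in> sets M" and Qpos: "0 < emeasure M Q" and Qfin: "emeasure M Q < \<infinity>"
    if "Q \<in> D" for Q
    using assms(2) that by (auto simp: dyadic_cubes_def)
  have fm: "Q \<in> fmeasurable M" if "Q \<in> D" for Q
    using meas[OF that] Qfin[OF that] by (simp add: fmeasurable_def)
  have nested: "S \<inter> T \<in> {S, T, {}}" if "S \<in> D" "T \<in> D" for S T
    using assms(2) that by (auto simp: dyadic_cubes_def)
  have \<psi>_pos: "0 < \<psi> Q" if "Q \<in> D" for Q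
    using Qpos[OF that] Qfin[OF that]
    by (simp add: \<psi>_def frac_content_def emeasure_eq_ennreal_measure less_top
        ennreal_less_zero_iff powr_gt_zero)
  have I_nonneg: "0 \<le> I Q" for Q
    unfolding I_def set_lebesgue_integral_def by (rule Bochner_Integration.integral_nonneg) simp
  have a_nonneg: "0 \<le> a Q" if "Q \<in> D" for Q
    using I_nonneg \<psi>_pos[OF that] by (simp add: a_def)
  have fmeas [measurable]: "f \<in> borel_measurable M"
    using assms(7) by (simp add: loc_integrable_def)
  have nn: "(\<integral>\<^sup>+y\<in>Q. ennreal (norm (f y)) \<partial>M) = (\<integral>\<^sup>+y. ennreal (indicator Q y *\<^sub>R norm (f y)) \<partial>M)"
    for Q by (rule nn_integral_cong) (auto simp: indicator_def)
  have int_f: "set_integrable M Q (\<lambda>y. norm (f y))" if "Q \<in> D" for Q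
    unfolding set_integrable_def
  proof (rule integrableI_nonneg)
    show "(\<integral>\<^sup>+y. ennreal (indicator Q y *\<^sub>R norm (f y)) \<partial>M) < \<infinity>"
      using assms(7) that unfolding loc_integrable_def nn by blast
  qed (use meas[OF that] in auto)
  have nn_I: "(\<integral>\<^sup>+y\<in>Q. ennreal (norm (f y)) \<partial>M) = ennreal (I Q)" if "Q \<in> D" for Q
    unfolding nn I_def set_lebesgue_integral_def
    by (rule nn_integral_eq_integral[OF int_f[OF that, unfolded set_integrable_def]]) simp
  have int_\<alpha>: "set_integrable M Q \<alpha>" if "Q \<in> D" for Q
    unfolding set_integrable_def
    by (rule integrableI_bounded_set_indicator[OF meas[OF that] assms(4) Qfin[OF that], of 1])
       (use assms(5) in auto)

  have fin: "finite (subcubes D Q\<^sub>0)" using assms(3) by (simp add: subcubes_def)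
  obtain \<S> where \<S>: "\<S> \<subseteq> subcubes D Q\<^sub>0"
    and grow: "\<And>S T. S \<in> \<S> \<Longrightarrow> T \<in> \<S> \<Longrightarrow> T \<subset> S \<Longrightarrow> \<Lambda> * a S < a T"
    and dom: "\<And>Q. Q \<in> subcubes D Q\<^sub>0 \<Longrightarrow> \<exists>S\<in>\<S>. Q \<subseteq> S \<and> a Q \<le> \<Lambda> * a S"
    by (rule stopping_family_exists[OF fin \<Lambda>(1), of a]) (auto simp: a_nonneg subcubes_def)
  have \<S>D: "S \<in> D" if "S \<in> \<S>" for S using \<S> that by (auto simp: subcubes_def)
  have fin\<S>: "finite \<S>" using \<S> fin by (rule finite_subset)
  define E where "E = minimal_part \<S>"

  have E_sets: "E S \<in> sets M" if "S \<in> \<S>" for S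
    unfolding E_def minimal_part_def
    by (intro sets.Diff sets.finite_Union) (use that meas \<S>D fin\<S> in auto)
  have major: "major_subset M \<eta> \<psi> S (E S)" if S: "S \<in> \<S>" for S
  proof -
    obtain \<C> where \<C>: "\<C> \<subseteq> {T \<in> \<S>. T \<subset> S}" "disjoint \<C>" "\<Union>\<C> = \<Union>{T \<in> \<S>. T \<subset> S}"
      by (rule nested_Union_eq_disjoint_Union[of "{T \<in> \<S>. T \<subset> S}"])
         (use fin\<S> nested \<S>D in auto)
    have CD: "T \<in> D" if "T \<in> \<C>" for T using that \<C>(1) \<S>D by auto
    have "\<psi> (\<Union>\<C>) \<le> \<psi> S / \<Lambda>"
      unfolding \<psi>_def
    proof (rule frac_content_growth_le[OF _ \<C>(2)])
      show "finite \<C>" by (rule finite_subset[OF \<C>(1)]) (simp add: fin\<S>)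
      show "\<Union>\<C> \<subseteq> S" using \<C>(1) by auto
      show "\<Lambda> * ((LINT x:S|M. norm (f x)) / frac_content M \<alpha> S)
          < (LINT x:T|M. norm (f x)) / frac_content M \<alpha> T" if "T \<in> \<C>" for T
        using grow[OF S, of T] \<C>(1) that by (auto simp: a_def I_def \<psi>_def)
    qed (use \<psi>_pos \<Lambda> fm int_\<alpha> int_f assms(5) CD \<S>D[OF S] in \<open>auto simp: \<psi>_def\<close>)
    moreover have "S - E S = \<Union>\<C>"
      unfolding E_def minimal_part_def \<C>(3) by auto
    ultimately show ?thesis
      using E_sets[OF S] by (auto simp: major_subset_def E_def minimal_part_def \<Lambda>_def mult.commute)
  qed
  have sparse: "sparse_with M \<eta> (frac_content M \<alpha>) \<S> E"
    using major disjoint_family_on_minimal_part[of \<S>] nested \<S>D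
    by (auto simp: sparse_with_def E_def \<psi>_def)

  have maximal: "frac_maximal M \<alpha> (subcubes D Q\<^sub>0) f x
      \<le> ennreal (\<Lambda> * (\<Sum>S\<in>\<S>. indicator (E S) x / \<psi> S * I S))" for x
    unfolding frac_maximal_def
  proof (rule SUP_least)
    fix Q assume Q: "Q \<in> subcubes D Q\<^sub>0"
    then have QD: "Q \<in> D" by (simp add: subcubes_def)
    show "indicator Q x / ennreal (frac_content M \<alpha> Q) * (\<integral>\<^sup>+y\<in>Q. ennreal (norm (f y)) \<partial>M)
      \<le> ennreal (\<Lambda> * (\<Sum>S\<in>\<S>. indicator (E S) x / \<psi> S * I S))"
    proof (cases "x \<in> Q")
      case True
      obtain S where S: "S \<in> \<S>" "Q \<subseteq> S" "a Q \<le> \<Lambda> * a S" using dom[OF Q] by blast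
      obtain T where T: "T \<in> \<S>" "T \<subseteq> S" "x \<in> E T"
        using minimal_part_below[OF fin\<S> S(1), of x] True S(2) by (auto simp: E_def)
      have "a S \<le> a T"
      proof (cases "T = S")
        case False
        have "1 * a S \<le> \<Lambda> * a S"
          using \<Lambda>(1) a_nonneg[OF \<S>D[OF S(1)]] by (rule mult_right_mono)
        also have "\<dots> < a T" using grow[OF S(1) T(1)] T(2) False by blast
        finally show ?thesis by simp
      qed simp
      also have "a T = indicator (E T) x / \<psi> T * I T" using T(3) by (simp add: a_def)
      also have "\<dots> \<le> (\<Sum>S\<in>\<S>. indicator (E S) x / \<psi> S * I S)"
        by (rule member_le_sum[OF T(1) _ fin\<S>])
           (use I_nonneg \<psi>_pos \<S>D in \<open>auto intro!: mult_nonneg_nonneg divide_nonneg_pos\<close>)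
      finally have "a Q \<le> \<Lambda> * (\<Sum>S\<in>\<S>. indicator (E S) x / \<psi> S * I S)"
        using S(3) \<Lambda>(2) by (meson mult_left_mono order_less_imp_le order_trans)
      moreover have "indicator Q x / ennreal (frac_content M \<alpha> Q)
          * (\<integral>\<^sup>+y\<in>Q. ennreal (norm (f y)) \<partial>M) = ennreal (a Q)"
      proof -
        have "1 / ennreal (\<psi> Q) * ennreal (I Q) = ennreal (1 / \<psi> Q) * ennreal (I Q)"
          using divide_ennreal[of 1 "\<psi> Q"] \<psi>_pos[OF QD] by simp
        also have "\<dots> = ennreal (a Q)"
          using \<psi>_pos[OF QD] I_nonneg by (simp add: a_def flip: ennreal_mult)
        finally show ?thesis using True by (simp add: nn_I[OF QD] \<psi>_def)
      qed
      ultimately show ?thesis by (simp add: ennreal_leI)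
    qed simp
  qed

  have operator: "\<Lambda> * (\<Sum>S\<in>\<S>. indicator (E S) x / \<psi> S * I S)
      \<le> \<Lambda> * sparse_operator M \<alpha> \<S> (\<lambda>y. norm (f y)) x" for x
  proof (rule mult_left_mono)
    show "(\<Sum>S\<in>\<S>. indicator (E S) x / \<psi> S * I S) \<le> sparse_operator M \<alpha> \<S> (\<lambda>y. norm (f y)) x"
      unfolding sparse_operator_def real_scaleR_def I_def[symmetric] \<psi>_def[symmetric]
    proof (rule sum_mono)
      fix S assume "S \<in> \<S>"
      have "indicator (E S) x \<le> (indicator S x :: real)"
        by (auto simp: E_def minimal_part_def indicator_def)
      then show "indicator (E S) x / \<psi> S * I S \<le> indicator S x / \<psi> S * I S"
        using \<psi>_pos[OF \<S>D[OF \<open>S \<in> \<S>\<close>]] I_nonneg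
        by (intro mult_right_mono divide_right_mono) auto
    qed
  qed (use \<Lambda> in auto)

  show ?thesis
    using \<S> sparse maximal operator
    unfolding \<Lambda>_def \<psi>_def I_def by (intro exI[of _ \<S>] exI[of _ E]) auto
qed

end
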